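(* Let $G$ be a Polish group. Suppose that $G$ has a dense subgroup which is a one-to-one continuous homomorphic pre-image of some compactly generated subgroup of $G^\omega$, i.e., there exist a dense subgroup $D \subseteq G$, a compact set $K \subseteq G^\omega$ and a continuous injective group homomorphism $\psi : G \to G^\omega$ such that $D = \psi^{-1}(\langle K \rangle)$. Then every $K_\sigma$ subgroup of $G^\omega$ is almost compactly generated.
   Context: $G^\omega$ is the countable power of $G$ with coordinatewise operations and the product topology. $\langle A \rangle$ denotes the subgroup generated (algebraically) by a set $A$; a subgroup is compactly generated if it equals $\langle K \rangle$ for some compact set $K$. A subset of a topological space is $K_\sigma$ if it is a countable union of compact sets. A subgroup $H$ of a topological group $\Gamma$ is almost compactly generated iff there are a compact set $K \subseteq \Gamma$ and a continuous, injective group homomorphism $\varphi : \Gamma \to \Gamma$ such that $H = \varphi^{-1}(\langle K \rangle)$. *)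

theory Defs
  imports "HOL-Analysis.Analysis" "HOL-Algebra.Algebra"
begin

locale topological_group = group G for G (structure) +
  fixes T :: "'a topology"
  assumes topspace_eq_carrier: "topspace T = carrier G"
    and continuous_mult: "continuous_map (prod_topology T T) T (\<lambda>(x, y). x \<otimes> y)"
    and continuous_inv: "continuous_map T T (\<lambda>x. inv x)"

locale polish_group = topological_group +
  assumes completely_metrizable: "completely_metrizable_space T"
    and separable: "separable_space T"

abbreviation power_group :: "('a, 'b) monoid_scheme \<Rightarrow> (nat \<Rightarrow> 'a) monoid"
  where "power_group G \<equiv> product_group (UNIV :: nat set) (\<lambda>_. G)"

abbreviation power_topology :: "'a topology \<Rightarrow> (nat \<Rightarrow> 'a) topology"
  where "power_topology T \<equiv> product_topology (\<lambda>_. T) (UNIV :: nat set)"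

definition K_sigma_in :: "'a topology \<Rightarrow> 'a set \<Rightarrow> bool"
  where "K_sigma_in T \<equiv> countable union_of compactin T"

definition almost_compactly_generated ::
    "('a, 'b) monoid_scheme \<Rightarrow> 'a topology \<Rightarrow> 'a set \<Rightarrow> bool"
  where "almost_compactly_generated G T H \<longleftrightarrow>
    subgroup H G \<and>
    (\<exists>K \<phi>. compactin T K \<and> continuous_map T T \<phi> \<and> \<phi> \<in> hom G G \<and> inj_on \<phi> (carrier G) \<and>
           H = {x \<in> carrier G. \<phi> x \<in> generate G K})"

end

theory Submission
  imports Defs
begin

text \<open>
  Write \<open>\<Gamma>\<close> for the power \<open>G\<^sup>\<omega>\<close>, and think of an element of \<open>\<Gamma>\<close> as a sequence of blocks, each of
  which is again an element of \<open>\<Gamma>\<close>. In a power, any sequence of compact sets converges to the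
  identity once its \<open>m\<close>-th member is small in the first \<open>m\<close> coordinates, so such a sequence has a
  compact union together with the identity, however wild the members are in their far coordinates.
  This is used twice.

  (1) The sequences that are trivial outside one block, with an element of \<open>K\<close> in that block, form
  a compact set up to the identity (\<open>compactin_single_blocks\<close>). They generate every blockwise
  image \<open>(\<psi> (d 0), \<psi> (d 1), \<dots>)\<close> of a sequence \<open>d\<close> of finite support with entries in \<open>D\<close>
  (\<open>blockwise_finite_support_in_generate\<close>).

  (2) Let \<open>L 0, L 1, \<dots>\<close> be compact subsets of \<open>\<Gamma>\<close>. Since \<open>D\<close> is dense, every
  \<open>x\<close> in \<open>L m\<close> can be divided by a sequence of \<open>m\<close> elements of \<open>D\<close> so that its first \<open>m\<close>
  coordinates come close to the identity; by compactness finitely many elements of \<open>D\<close> suffice for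
  all of \<open>L m\<close>. The quotients form one compact set \<open>Z\<close>, which contains the whole \<open>K\<^sub>\<sigma>\<close> set modulo
  finitely supported sequences in \<open>D\<close>, and each member of which agrees far out with a member of the
  \<open>K\<^sub>\<sigma>\<close> set or with the identity (\<open>compact_modulo_dense_finite_support\<close>).

  Now let \<open>r x\<close> repeat each coordinate of \<open>x\<close> infinitely often, let \<open>\<phi> x\<close> be the blockwise image of
  \<open>r x\<close> under \<open>\<psi>\<close>, and let \<open>C\<close> consist of the compact set of (1) and of the blockwise image of the
  set \<open>Z\<close> that (2) yields for \<open>r ` H\<close>. If \<open>x\<close> lies in \<open>H\<close>, then \<open>\<phi> x\<close> is the product of a member
  of \<open>C\<close> from (2) and a blockwise image as in (1). Conversely, all members of \<open>C\<close>, hence all members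
  of the subgroup that it generates, agree in the far blocks with the blockwise image of some \<open>r h\<close>
  with \<open>h\<close> in \<open>H\<close>. As the far blocks of \<open>\<phi> x\<close> still show all coordinates of \<open>x\<close>, through
  the injective map \<open>\<psi>\<close>, this forces \<open>x = h\<close>.
\<close>

section \<open>Compact sets obtained from null sequences of compact sets\<close>

text \<open>An open set of a cover that contains the limit point \<open>a\<close> already covers all but finitely many
  of the sets; the others have a compact union.\<close>

lemma compactin_insert_limit:
  assumes a: "a \<in> topspace S"
    and Z: "\<And>m::nat. compactin S (Z m)"
    and lim: "\<And>U. openin S U \<Longrightarrow> a \<in> U \<Longrightarrow> \<exists>N. \<forall>m\<ge>N. Z m \<subseteq> U"
  shows "compactin S (insert a (\<Union>m. Z m))"
  unfolding compactin_def
proof (intro conjI allI impI)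
  show "insert a (\<Union>m. Z m) \<subseteq> topspace S"
    using a Z compactin_subset_topspace by blast
next
  fix \<U> assume \<U>: "(\<forall>U\<in>\<U>. openin S U) \<and> insert a (\<Union>m. Z m) \<subseteq> \<Union>\<U>"
  then obtain U where U: "U \<in> \<U>" "a \<in> U" "openin S U" by auto
  obtain N where N: "\<And>m. m \<ge> N \<Longrightarrow> Z m \<subseteq> U" using lim U by blast
  have "compactin S (\<Union>m\<in>{..<N}. Z m)"
    using Z by (intro compactin_Union) auto
  moreover have "(\<Union>m\<in>{..<N}. Z m) \<subseteq> \<Union>\<U>" using \<U> by blast
  ultimately obtain \<F> where \<F>: "finite \<F>" "\<F> \<subseteq> \<U>" "(\<Union>m\<in>{..<N}. Z m) \<subseteq> \<Union>\<F>"
    using \<U> unfolding compactin_def by meson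
  have "Z m \<subseteq> \<Union>(insert U \<F>)" for m
    using N[of m] \<F>(3) by (cases "m < N") (fastforce, simp add: le_supI1)
  then have "insert a (\<Union>m. Z m) \<subseteq> \<Union>(insert U \<F>)"
    using U(2) by blast
  then show "\<exists>\<F>. finite \<F> \<and> \<F> \<subseteq> \<U> \<and> insert a (\<Union>m. Z m) \<subseteq> \<Union>\<F>"
    using \<F>(1,2) U(1) by (intro exI[of _ "insert U \<F>"]) auto
qed

text \<open>Convergence in a power is convergence in each coordinate, because a basic open set
  restricts finitely many coordinates only.\<close>

lemma compactin_power_insert_limit:
  assumes a: "a \<in> topspace (power_topology T)"
    and Z: "\<And>m::nat. compactin (power_topology T) (Z m)"
    and lim: "\<And>p V. openin T V \<Longrightarrow> a p \<in> V \<Longrightarrow> \<exists>N. \<forall>m\<ge>N. \<forall>z\<in>Z m. z p \<in> V"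
  shows "compactin (power_topology T) (insert a (\<Union>m. Z m))"
proof (rule compactin_insert_limit[OF a Z])
  fix U assume "openin (power_topology T) U" "a \<in> U"
  then obtain V where V: "finite {p. V p \<noteq> topspace T}" "\<And>p. openin T (V p)"
    "a \<in> PiE UNIV V" "PiE UNIV V \<subseteq> U"
    unfolding openin_product_topology_alt by auto
  have "\<exists>N. \<forall>m\<ge>N. \<forall>z\<in>Z m. z p \<in> V p" for p
    using lim[of "V p" p] V(2,3) by (auto simp: PiE_UNIV_domain)
  then obtain N where N: "\<And>p m z. m \<ge> N p \<Longrightarrow> z \<in> Z m \<Longrightarrow> z p \<in> V p" by metis
  obtain M where M: "\<And>p. V p \<noteq> topspace T \<Longrightarrow> N p \<le> M"
    using V(1) finite_nat_set_iff_bounded_le[of "N ` {p. V p \<noteq> topspace T}"] by auto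
  have "z p \<in> V p" if "m \<ge> M" "z \<in> Z m" for m z p
  proof (cases "V p = topspace T")
    case True
    then show ?thesis
      using compactin_subset_topspace[OF Z[of m]] that(2) by (auto simp: PiE_UNIV_domain)
  next
    case False
    then show ?thesis using M[OF False] N[of p m z] that by auto
  qed
  then have "\<forall>m\<ge>M. Z m \<subseteq> U"
    using V(4) by (auto simp: PiE_UNIV_domain Pi_iff subset_iff)
  then show "\<exists>M. \<forall>m\<ge>M. Z m \<subseteq> U" by blast
qed

text \<open>The closed sets \<open>W m\<close> cut compact sets down to compact sets, while the open sets \<open>U m\<close> inside
  them can be met by a dense set.\<close>

lemma metrizable_space_closed_neighbourhood_base:
  assumes "metrizable_space S" "a \<in> topspace S"
  obtains U W :: "nat \<Rightarrow> 'a set"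
  where "\<And>m. openin S (U m)" "\<And>m. a \<in> U m" "\<And>m. U m \<subseteq> W m" "\<And>m. closedin S (W m)"
    "\<And>V. openin S V \<Longrightarrow> a \<in> V \<Longrightarrow> \<exists>N. \<forall>m\<ge>N. W m \<subseteq> V"
proof -
  obtain M d where "Metric_space M d" and S: "S = Metric_space.mtopology M d"
    using assms(1) unfolding metrizable_space_def by blast
  then interpret Metric_space M d by simp
  have a: "a \<in> M" using assms(2) S by simp
  show thesis
  proof (rule that[of "\<lambda>m. mball a (1 / Suc m)" "\<lambda>m. mcball a (1 / Suc m)"])
    fix V assume "openin S V" "a \<in> V"
    then obtain r where r: "r > 0" "mcball a r \<subseteq> V"
      unfolding S openin_mtopology_mcball by blast
    obtain N where N: "1 / real (Suc N) < r"
      using r(1) nat_approx_posE by blast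
    have "mcball a (1 / Suc m) \<subseteq> V" if "m \<ge> N" for m
    proof -
      have "1 / real (Suc m) \<le> 1 / real (Suc N)"
        using that by (intro divide_left_mono) auto
      then show ?thesis using N r(2) by fastforce
    qed
    then show "\<exists>N. \<forall>m\<ge>N. mcball a (1 / Suc m) \<subseteq> V" by blast
  qed (auto simp: S a)
qed

section \<open>Correcting a \<open>K\<^sub>\<sigma>\<close> set by sequences of finite support\<close>

declare restrict_UNIV [simp]

lemma (in group) in_carrier_power_group:
  "x \<in> carrier (power_group G) \<longleftrightarrow> (\<forall>p. x p \<in> carrier G)"
  by (auto simp: PiE_UNIV_domain)

lemma (in group) group_power_group: "group (power_group G)"
  by (simp add: group_axioms)

context topological_group
begin

lemma topspace_power_topology: "topspace (power_topology T) = carrier (power_group G)"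
  by (simp add: topspace_eq_carrier)

lemma continuous_map_divide:
  assumes "continuous_map S T f" "continuous_map S T g"
  shows "continuous_map S T (\<lambda>x. f x \<otimes> inv g x)"
proof -
  have "continuous_map S T (\<lambda>x. inv g x)"
    using continuous_map_compose[OF assms(2) continuous_inv] by (simp add: o_def)
  then have "continuous_map S (prod_topology T T) (\<lambda>x. (f x, inv g x))"
    using assms(1) by (simp add: continuous_map_paired)
  from continuous_map_compose[OF this continuous_mult] show ?thesis
    by (simp add: o_def)
qed

text \<open>The translates of \<open>U\<close> by elements of \<open>D\<close> cover the whole group: the \<open>g\<close> with
  \<open>y \<otimes> inv g \<in> U\<close> form an open set that contains \<open>y\<close>, so \<open>D\<close> meets it.\<close>

lemma compact_covered_by_finite_translates:
  assumes dense: "T closure_of D = topspace T" "D \<subseteq> carrier G"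
    and P: "compactin T P" and U: "openin T U" "\<one> \<in> U"
  obtains E where "finite E" "E \<subseteq> D" "\<And>y. y \<in> P \<Longrightarrow> \<exists>d\<in>E. y \<otimes> inv d \<in> U"
proof -
  define C where "C d = {y \<in> topspace T. y \<otimes> inv d \<in> U}" for d
  have "openin T (C d)" if "d \<in> D" for d
  proof -
    have "d \<in> topspace T" using that dense(2) by (auto simp: topspace_eq_carrier)
    then have "continuous_map T T (\<lambda>y. y \<otimes> inv d)"
      using continuous_map_divide[of T "\<lambda>y. y" "\<lambda>_. d"] by simp
    then show ?thesis
      unfolding C_def using U(1) by (rule openin_continuous_map_preimage)
  qed
  moreover have "P \<subseteq> \<Union>(C ` D)"
  proof
    fix y assume "y \<in> P"
    then have y: "y \<in> topspace T"
      using P compactin_subset_topspace by blast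
    let ?V = "{g \<in> topspace T. y \<otimes> inv g \<in> U}"
    have "continuous_map T T (\<lambda>g. y \<otimes> inv g)"
      using continuous_map_divide[of T "\<lambda>_. y" "\<lambda>g. g"] y by simp
    then have "openin T ?V"
      using U(1) by (rule openin_continuous_map_preimage)
    moreover have "y \<in> ?V" using y U(2) by (simp add: topspace_eq_carrier)
    ultimately have "D \<inter> ?V \<noteq> {}"
      using dense(1)[unfolded dense_intersects_open, rule_format, of ?V] by blast
    then show "y \<in> \<Union>(C ` D)" using y by (auto simp: C_def)
  qed
  ultimately have C: "\<forall>V \<in> C ` D. openin T V" "P \<subseteq> \<Union>(C ` D)" by simp_all
  then obtain \<F> where \<F>: "finite \<F>" "\<F> \<subseteq> C ` D" "P \<subseteq> \<Union>\<F>"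
    using P[unfolded compactin_def, THEN conjunct2, rule_format, of "C ` D"] by auto
  obtain E where E: "E \<subseteq> D" "finite E" "\<F> = C ` E"
    using finite_subset_image[OF \<F>(1,2)] by (elim exE conjE)
  show thesis
  proof (rule that[OF E(2,1)])
    fix y assume "y \<in> P"
    then show "\<exists>d\<in>E. y \<otimes> inv d \<in> U"
      using \<F>(3) unfolding E(3) C_def by auto
  qed
qed

text \<open>A \<open>K\<^sub>\<sigma>\<close> subset of the power need not be contained in a compact set, but it is so modulo finitely
  supported sequences in a dense set \<open>D\<close>. Such a correction is invisible in the far coordinates,
  and these will suffice to recover the original element.\<close>

lemma compact_modulo_dense_finite_support:
  fixes L :: "nat \<Rightarrow> (nat \<Rightarrow> 'a) set"
  assumes metrizable: "metrizable_space T"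
    and dense: "T closure_of D = topspace T" "D \<subseteq> carrier G"
    and L: "\<And>m. compactin (power_topology T) (L m)"
  obtains Z where "compactin (power_topology T) Z"
    "\<And>z. z \<in> Z \<Longrightarrow> \<exists>x \<in> insert (\<lambda>_. \<one>) (\<Union>m. L m). \<exists>N. \<forall>p\<ge>N. z p = x p"
    "\<And>m x. x \<in> L m \<Longrightarrow>
       \<exists>d. (\<forall>p<m. d p \<in> D) \<and> (\<forall>p\<ge>m. d p = \<one>) \<and> (\<lambda>p. x p \<otimes> inv d p) \<in> Z"
proof -
  have one: "\<one> \<in> topspace T" by (simp add: topspace_eq_carrier)
  obtain U W where U: "\<And>m::nat. openin T (U m)" "\<And>m. \<one> \<in> U m" "\<And>m. U m \<subseteq> W m"
    and W: "\<And>m. closedin T (W m)"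
      "\<And>V. openin T V \<Longrightarrow> \<one> \<in> V \<Longrightarrow> \<exists>N. \<forall>m\<ge>N. W m \<subseteq> V"
    by (rule metrizable_space_closed_neighbourhood_base[OF metrizable one]) (rule that)
  have "\<exists>E. finite E \<and> E \<subseteq> D \<and> (\<forall>x \<in> L m. \<exists>d\<in>E. x p \<otimes> inv d \<in> U m)" for m p
  proof -
    have "compactin T ((\<lambda>x. x p) ` L m)"
      by (rule image_compactin[OF L continuous_map_product_projection]) simp
    then obtain E where E: "finite E" "E \<subseteq> D" "\<And>y. y \<in> (\<lambda>x. x p) ` L m \<Longrightarrow> \<exists>d\<in>E. y \<otimes> inv d \<in> U m"
      by (rule compact_covered_by_finite_translates[OF dense _ U(1)[of m] U(2)[of m]])
        (rule that)
    have "\<forall>x \<in> L m. \<exists>d\<in>E. x p \<otimes> inv d \<in> U m"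
      by (intro ballI E(3) imageI)
    then show ?thesis using E(1,2) by (intro exI[of _ E] conjI)
  qed
  then have "\<forall>m p. \<exists>E. finite E \<and> E \<subseteq> D \<and> (\<forall>x \<in> L m. \<exists>d\<in>E. x p \<otimes> inv d \<in> U m)"
    by (intro allI)
  then obtain E where "\<forall>m p. finite (E m p) \<and> E m p \<subseteq> D
      \<and> (\<forall>x \<in> L m. \<exists>d\<in>E m p. x p \<otimes> inv d \<in> U m)"
    unfolding choice_iff by (elim exE)
  then have E: "\<And>m p. finite (E m p)" "\<And>m p. E m p \<subseteq> D"
    "\<And>m p x. x \<in> L m \<Longrightarrow> \<exists>d\<in>E m p. x p \<otimes> inv d \<in> U m"
    by simp_all
  \<comment> \<open>\<open>F m\<close> is the set of admissible divisors for \<open>L m\<close>; in \<open>Z m\<close> only those quotients are kept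
    whose first \<open>m\<close> entries are close to the identity. The sets \<open>W m\<close> are closed, so \<open>Z m\<close> stays
    compact.\<close>
  define F where "F m = PiE UNIV (\<lambda>p. if p < m then E m p else {\<one>})" for m
  define Z where "Z m = (\<lambda>(x, d) p. x p \<otimes> inv d p) ` (L m \<times> F m)
      \<inter> PiE UNIV (\<lambda>p. if p < m then W m else topspace T)" for m
  have compact_Z: "compactin (power_topology T) (Z m)" for m
  proof -
    have "compactin T (E m p)" for p
      using E(1,2)[of m p] dense(2) topspace_eq_carrier by (intro finite_imp_compactin) auto
    then have "compactin (power_topology T) (F m)"
      unfolding F_def compactin_PiE using one by (auto intro: finite_imp_compactin)
    then have 1: "compactin (prod_topology (power_topology T) (power_topology T)) (L m \<times> F m)"
      using L by (simp add: compactin_Times)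
    have 2: "continuous_map (prod_topology (power_topology T) (power_topology T))
        (power_topology T) (\<lambda>(x, d) p. x p \<otimes> inv d p)"
    proof -
      have "continuous_map (prod_topology (power_topology T) (power_topology T)) T
          (\<lambda>z. fst z p \<otimes> inv (snd z p))" for p
        using continuous_map_compose[OF continuous_map_fst continuous_map_product_projection[of p UNIV "\<lambda>_. T"]]
          continuous_map_compose[OF continuous_map_snd continuous_map_product_projection[of p UNIV "\<lambda>_. T"]]
        by (intro continuous_map_divide) (auto simp: o_def)
      then show ?thesis
        by (simp add: continuous_map_componentwise_UNIV case_prod_unfold)
    qed
    have 3: "closedin (power_topology T) (PiE UNIV (\<lambda>p. if p < m then W m else topspace T))"
      using W(1) by (simp add: closedin_product_topology)
    show ?thesis
      unfolding Z_def by (intro compact_Int_closedin image_compactin[OF 1 2] 3)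
  qed
  show thesis
  proof (rule that[of "insert (\<lambda>_. \<one>) (\<Union>m. Z m)"])
    show "compactin (power_topology T) (insert (\<lambda>_. \<one>) (\<Union>m. Z m))"
    proof (rule compactin_power_insert_limit[OF _ compact_Z])
      show "(\<lambda>_. \<one>) \<in> topspace (power_topology T)"
        using one by (simp add: PiE_UNIV_domain)
      fix p V assume "openin T V" "\<one> \<in> V"
      then obtain N where N: "\<And>m. m \<ge> N \<Longrightarrow> W m \<subseteq> V" using W(2) by blast
      have "z p \<in> V" if "m \<ge> max N (Suc p)" "z \<in> Z m" for m z
      proof -
        have "z p \<in> (if p < m then W m else topspace T)"
          using that(2) unfolding Z_def by (blast dest: PiE_mem)
        then show ?thesis using that(1) N[of m] by auto
      qed
      then show "\<exists>N. \<forall>m\<ge>N. \<forall>z\<in>Z m. z p \<in> V" by blast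
    qed
  next
    fix z assume "z \<in> insert (\<lambda>_. \<one>) (\<Union>m. Z m)"
    then consider "z = (\<lambda>_. \<one>)" | m x d where "x \<in> L m" "d \<in> F m" "z = (\<lambda>p. x p \<otimes> inv d p)"
      unfolding Z_def by auto
    then show "\<exists>x \<in> insert (\<lambda>_. \<one>) (\<Union>m. L m). \<exists>N. \<forall>p\<ge>N. z p = x p"
    proof cases
      case 1
      then show ?thesis by auto
    next
      case 2
      have "x p \<in> carrier G" for p
        using compactin_subset_topspace[OF L, of m] 2(1)
        unfolding topspace_power_topology subset_iff in_carrier_power_group by simp
      moreover have "d p = \<one>" if "p \<ge> m" for p
        using PiE_mem[OF 2(2)[unfolded F_def], of p] that by simp
      ultimately have "\<forall>p\<ge>m. z p = x p" using 2(3) by simp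
      then show ?thesis using 2(1) by blast
    qed
  next
    fix m x assume x: "x \<in> L m"
    then have xc: "x p \<in> carrier G" for p
      using compactin_subset_topspace[OF L, of m]
      unfolding topspace_power_topology subset_iff in_carrier_power_group by simp
    obtain e where e: "\<And>p. e p \<in> E m p" "\<And>p. x p \<otimes> inv (e p) \<in> U m"
    proof -
      have "\<forall>p. \<exists>d. d \<in> E m p \<and> x p \<otimes> inv d \<in> U m" using E(3)[OF x] by blast
      then show thesis unfolding choice_iff using that by blast
    qed
    define d where "d p = (if p < m then e p else \<one>)" for p
    have "d \<in> F m" using e(1) by (auto simp: F_def d_def PiE_UNIV_domain)
    moreover have "x p \<otimes> inv d p \<in> (if p < m then W m else topspace T)" for p
      using e(2)[of p] U(3)[of m] xc[of p] by (auto simp: d_def topspace_eq_carrier)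
    ultimately have "(\<lambda>p. x p \<otimes> inv d p) \<in> Z m"
      unfolding Z_def using x
      by (intro IntI image_eqI[of _ _ "(x, d)"]) (simp_all add: PiE_UNIV_domain)
    moreover have "d p \<in> D" if "p < m" for p
      using that e(1)[of p] E(2) by (auto simp: d_def)
    ultimately show "\<exists>d. (\<forall>p<m. d p \<in> D) \<and> (\<forall>p\<ge>m. d p = \<one>)
        \<and> (\<lambda>p. x p \<otimes> inv d p) \<in> insert (\<lambda>_. \<one>) (\<Union>m. Z m)"
      by (intro exI[of _ d]) (auto simp: d_def)
  qed
qed

end

section \<open>Sequences of blocks\<close>

text \<open>The bijection of \<open>nat \<times> nat\<close> with \<open>nat\<close> identifies a sequence of sequences with a single
  sequence: the index \<open>q\<close> belongs to the entry \<open>entry q\<close> of the block \<open>block q\<close>.\<close>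

definition block :: "nat \<Rightarrow> nat" where "block q = fst (prod_decode q)"
definition entry :: "nat \<Rightarrow> nat" where "entry q = snd (prod_decode q)"

lemma block_encode [simp]: "block (prod_encode (p, i)) = p"
  and entry_encode [simp]: "entry (prod_encode (p, i)) = i"
  by (simp_all add: block_def entry_def)

lemma infinitely_many_indices_in_block: "\<exists>p\<ge>N. block p = j"
  by (rule exI[of _ "prod_encode (j, N)"]) (simp add: le_prod_encode_2)

definition blockwise :: "('a \<Rightarrow> nat \<Rightarrow> 'b) \<Rightarrow> (nat \<Rightarrow> 'a) \<Rightarrow> nat \<Rightarrow> 'b"
  where "blockwise f z q = f (z (block q)) (entry q)"

definition in_block :: "('a, 'b) monoid_scheme \<Rightarrow> nat \<Rightarrow> (nat \<Rightarrow> 'a) \<Rightarrow> nat \<Rightarrow> 'a"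
  where "in_block G p k q = (if block q = p then k (entry q) else \<one>\<^bsub>G\<^esub>)"

lemma blockwise_eqD:
  assumes "\<And>q. block q = p \<Longrightarrow> blockwise f z q = blockwise f z' q"
  shows "f (z p) = f (z' p)"
proof
  fix i
  show "f (z p) i = f (z' p) i"
    using assms[of "prod_encode (p, i)"] by (simp add: blockwise_def)
qed

lemma continuous_map_blockwise:
  assumes "continuous_map T (power_topology T) f"
  shows "continuous_map (power_topology T) (power_topology T) (blockwise f)"
  unfolding continuous_map_componentwise_UNIV blockwise_def
proof
  fix q
  have "continuous_map T T (\<lambda>x. f x (entry q))"
    using assms by (simp add: continuous_map_componentwise_UNIV)
  from continuous_map_compose[OF continuous_map_product_projection[of "block q" UNIV "\<lambda>_. T"] this]
  show "continuous_map (power_topology T) T (\<lambda>z. f (z (block q)) (entry q))"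
    by (simp add: o_def)
qed

context group
begin

lemma group_hom_blockwise:
  assumes "f \<in> hom G (power_group G)"
  shows "group_hom (power_group G) (power_group G) (blockwise f)"
proof -
  have c: "f x i \<in> carrier G" if "x \<in> carrier G" for x i
    using assms that in_carrier_power_group hom_in_carrier by metis
  have m: "f (x \<otimes> y) i = f x i \<otimes> f y i" if "x \<in> carrier G" "y \<in> carrier G" for x y i
    using hom_mult[OF assms that] by simp
  show ?thesis
    by (intro group_hom.intro group_hom_axioms.intro group_power_group homI)
       (auto simp: PiE_UNIV_domain Pi_iff blockwise_def fun_eq_iff c m)
qed

lemma group_hom_in_block: "group_hom (power_group G) (power_group G) (in_block G p)"
  by (intro group_hom.intro group_hom_axioms.intro group_power_group homI)
     (auto simp: PiE_UNIV_domain Pi_iff in_block_def fun_eq_iff)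

text \<open>Induction on the length of the support: the last block \<open>f (d m)\<close> splits off, and it is a product
  of members of \<open>C\<close> because \<open>in_block G m\<close> is a homomorphism.\<close>

lemma blockwise_finite_support_in_generate:
  assumes f: "f \<in> hom G (power_group G)" and K: "K \<subseteq> carrier (power_group G)"
    and C: "\<And>p. in_block G p ` K \<subseteq> C"
    and d: "\<And>p. p < m \<Longrightarrow> d p \<in> carrier G \<and> f (d p) \<in> generate (power_group G) K"
      "\<And>p. p \<ge> m \<Longrightarrow> d p = \<one>"
  shows "blockwise f d \<in> generate (power_group G) C"
  using d
proof (induction m arbitrary: d)
  case 0
  then have "d = \<one>\<^bsub>power_group G\<^esub>" by auto
  then have "blockwise f d = \<one>\<^bsub>power_group G\<^esub>"
    using group_hom.hom_one[OF group_hom_blockwise[OF f]] by simp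
  then show ?case using generate.one by metis
next
  case (Suc m)
  interpret \<iota>: group_hom "power_group G" "power_group G" "in_block G m"
    by (rule group_hom_in_block)
  let ?d = "d(m := \<one>)"
  have dc: "d p \<in> carrier G" for p
    using Suc.prems(1)[of p] Suc.prems(2)[of p] by (cases "p < Suc m") auto
  have fc: "f x i \<in> carrier G" if "x \<in> carrier G" for x i
    using f that in_carrier_power_group hom_in_carrier by metis
  have f1: "f \<one> = (\<lambda>_. \<one>)"
    using hom_one[OF f group_axioms group_power_group] by simp
  have "in_block G m (f (d m)) \<in> in_block G m ` generate (power_group G) K"
    using Suc.prems(1)[of m] by blast
  also have "\<dots> = generate (power_group G) (in_block G m ` K)"
    using \<iota>.generate_img[OF K] by simp
  also have "\<dots> \<subseteq> generate (power_group G) C"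
    by (rule group.mono_generate[OF group_power_group C])
  finally have 1: "in_block G m (f (d m)) \<in> generate (power_group G) C" .
  have 2: "blockwise f ?d \<in> generate (power_group G) C"
    using Suc.prems by (intro Suc.IH) auto
  have "blockwise f d = blockwise f ?d \<otimes>\<^bsub>power_group G\<^esub> in_block G m (f (d m))"
    by (auto simp: fun_eq_iff blockwise_def in_block_def f1 fc dc)
  then show ?case using generate.eng[OF 2 1] by simp
qed

end

context topological_group
begin

lemma continuous_map_in_block:
  "continuous_map (power_topology T) (power_topology T) (in_block G p)"
  unfolding continuous_map_componentwise_UNIV
proof
  fix q
  show "continuous_map (power_topology T) T (\<lambda>k. in_block G p k q)"
    by (cases "block q = p")
       (auto simp: in_block_def topspace_eq_carrier intro: continuous_map_product_projection)
qed

text \<open>The copies of \<open>K\<close> in the successive blocks converge to the identity, since each coordinate is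
  trivial in all copies but one.\<close>

lemma compactin_single_blocks:
  assumes K: "compactin (power_topology T) K"
  shows "compactin (power_topology T) (insert (\<lambda>_. \<one>) (\<Union>p. in_block G p ` K))"
proof (rule compactin_power_insert_limit)
  show "(\<lambda>_. \<one>) \<in> topspace (power_topology T)"
    by (simp add: topspace_eq_carrier PiE_UNIV_domain)
  show "compactin (power_topology T) (in_block G p ` K)" for p
    by (rule image_compactin[OF K continuous_map_in_block])
  fix q V assume "openin T V" "\<one> \<in> V"
  then have "\<forall>p\<ge>Suc (block q). \<forall>z\<in>in_block G p ` K. z q \<in> V"
    by (auto simp: in_block_def)
  then show "\<exists>N. \<forall>p\<ge>N. \<forall>z\<in>in_block G p ` K. z q \<in> V" by blast
qed

end

section \<open>Recovering the subgroup from the far blocks\<close>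

text \<open>The invariant of the generated subgroup: it does not see the corrections in the first blocks.\<close>

definition eventually_blockwise_in ::
  "('a, 'b) monoid_scheme \<Rightarrow> ('a \<Rightarrow> nat \<Rightarrow> 'a) \<Rightarrow> (nat \<Rightarrow> 'a) set \<Rightarrow> (nat \<Rightarrow> 'a) set"
  where "eventually_blockwise_in G f H =
    {w \<in> carrier (power_group G).
       \<exists>h\<in>H. \<exists>N. \<forall>q. N \<le> block q \<longrightarrow> w q = blockwise f h q}"

lemma (in group) subgroup_eventually_blockwise_in:
  assumes f: "f \<in> hom G (power_group G)" and H: "subgroup H (power_group G)"
  shows "subgroup (eventually_blockwise_in G f H) (power_group G)"
proof -
  interpret P: group "power_group G" by (rule group_power_group)
  interpret B: group_hom "power_group G" "power_group G" "blockwise f"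
    by (rule group_hom_blockwise[OF f])
  have Hc: "h \<in> carrier (power_group G)" if "h \<in> H" for h
    using H that subgroup.subset by blast
  show ?thesis
  proof (rule P.subgroupI)
    show "eventually_blockwise_in G f H \<subseteq> carrier (power_group G)"
      by (auto simp: eventually_blockwise_in_def)
    have "\<one>\<^bsub>power_group G\<^esub> \<in> H" by (rule subgroup.one_closed[OF H])
    then show "eventually_blockwise_in G f H \<noteq> {}"
      using Hc B.hom_closed unfolding eventually_blockwise_in_def by blast
  next
    fix v assume "v \<in> eventually_blockwise_in G f H"
    then obtain h N where v: "v \<in> carrier (power_group G)" "h \<in> H"
      "\<And>q. N \<le> block q \<Longrightarrow> v q = blockwise f h q"
      unfolding eventually_blockwise_in_def by blast
    have iv: "inv\<^bsub>power_group G\<^esub> w = (\<lambda>q. inv w q)" if "w \<in> carrier (power_group G)" for w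
      using that inv_product_group[of w UNIV "\<lambda>_. G"] group_axioms by simp
    have "blockwise f (inv\<^bsub>power_group G\<^esub> h) = (\<lambda>q. inv blockwise f h q)"
      using B.hom_inv[OF Hc[OF v(2)]] iv[OF B.hom_closed[OF Hc[OF v(2)]]] by simp
    then have "\<forall>q. N \<le> block q \<longrightarrow>
        (inv\<^bsub>power_group G\<^esub> v) q = blockwise f (inv\<^bsub>power_group G\<^esub> h) q"
      using v(3) iv[OF v(1)] by simp
    then show "inv\<^bsub>power_group G\<^esub> v \<in> eventually_blockwise_in G f H"
      unfolding eventually_blockwise_in_def
      using P.inv_closed[OF v(1)] subgroup.m_inv_closed[OF H v(2)] by blast
  next
    fix v w assume "v \<in> eventually_blockwise_in G f H" "w \<in> eventually_blockwise_in G f H"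
    then obtain h k M N where v: "v \<in> carrier (power_group G)" "h \<in> H"
        "\<And>q. M \<le> block q \<Longrightarrow> v q = blockwise f h q"
      and w: "w \<in> carrier (power_group G)" "k \<in> H"
        "\<And>q. N \<le> block q \<Longrightarrow> w q = blockwise f k q"
      unfolding eventually_blockwise_in_def by blast
    have "blockwise f (h \<otimes>\<^bsub>power_group G\<^esub> k) = (\<lambda>q. blockwise f h q \<otimes> blockwise f k q)"
      using B.hom_mult[OF Hc[OF v(2)] Hc[OF w(2)]] by (simp del: mult_product_group) simp
    then have "\<forall>q. max M N \<le> block q \<longrightarrow>
        (v \<otimes>\<^bsub>power_group G\<^esub> w) q = blockwise f (h \<otimes>\<^bsub>power_group G\<^esub> k) q"
      using v(3) w(3) by (simp)
    then show "v \<otimes>\<^bsub>power_group G\<^esub> w \<in> eventually_blockwise_in G f H"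
      unfolding eventually_blockwise_in_def
      using P.m_closed[OF v(1) w(1)] subgroup.m_closed[OF H v(2) w(2)] by blast
  qed
qed

section \<open>Almost compactly generated subgroups\<close>

text \<open>Metrizability supplies the sequence of neighbourhoods of the identity that drives the
  corrections. Density of \<open>D\<close> is what makes the corrections possible, and compact generation modulo
  \<open>\<psi>\<close> is what makes them available in the generated subgroup.\<close>

theorem (in topological_group) K_sigma_subgroup_almost_compactly_generated:
  assumes metrizable: "metrizable_space T"
    and dense: "T closure_of D = topspace T"
    and K: "compactin (power_topology T) K"
    and \<psi>: "continuous_map T (power_topology T) \<psi>"
      "\<psi> \<in> hom G (power_group G)" "inj_on \<psi> (carrier G)"
    and D: "D = {x \<in> carrier G. \<psi> x \<in> generate (power_group G) K}"
    and H: "subgroup H (power_group G)" "K_sigma_in (power_topology T) H"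
  shows "almost_compactly_generated (power_group G) (power_topology T) H"
proof -
  interpret P: group "power_group G" by (rule group_power_group)
  interpret B: group_hom "power_group G" "power_group G" "blockwise \<psi>"
    by (rule group_hom_blockwise[OF \<psi>(2)])
  have Dc: "D \<subseteq> carrier G" unfolding D by blast
  have Kc: "K \<subseteq> carrier (power_group G)"
    using compactin_subset_topspace[OF K] topspace_power_topology by simp
  have Hc: "H \<subseteq> carrier (power_group G)" using H(1) subgroup.subset by blast

  \<comment> \<open>The map \<open>block\<close> takes every value infinitely often, so here it serves to repeat each
    coordinate of \<open>x\<close> beyond any bound.\<close>
  define r where "r x = x \<circ> block" for x :: "nat \<Rightarrow> 'a"
  interpret r: group_hom "power_group G" "power_group G" r
    by (intro group_hom.intro group_hom_axioms.intro group_power_group homI)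
       (auto simp: r_def PiE_UNIV_domain Pi_iff fun_eq_iff)
  have r_cont: "continuous_map (power_topology T) (power_topology T) r"
    unfolding continuous_map_componentwise_UNIV r_def o_def
    by (intro allI continuous_map_product_projection UNIV_I)
  have rH: "subgroup (r ` H) (power_group G)"
    using H(1) by (rule r.subgroup_img_is_subgroup)
  have one_rH: "(\<lambda>_. \<one>) \<in> r ` H"
    using subgroup.one_closed[OF rH] by simp
  define \<phi> where "\<phi> = blockwise \<psi> \<circ> r"

  obtain \<U> where \<U>: "countable \<U>" "\<And>A. A \<in> \<U> \<Longrightarrow> compactin (power_topology T) A" "\<Union>\<U> = H"
    using H(2) unfolding K_sigma_in_def union_of_def by blast
  define L where "L = (\<lambda>m. r ` from_nat_into \<U> m)"
  have "\<U> \<noteq> {}" using \<U>(3) one_rH by blast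
  then have range: "range (from_nat_into \<U>) = \<U>" using \<U>(1) by simp
  have L_compact: "compactin (power_topology T) (L m)" for m
    unfolding L_def using range \<U>(2) by (intro image_compactin[OF _ r_cont]) blast
  have L_Union: "(\<Union>m. L m) = r ` H"
    unfolding L_def \<U>(3)[symmetric] by (subst (2) range[symmetric]) blast

  obtain Z where Z: "compactin (power_topology T) Z"
    "\<And>z. z \<in> Z \<Longrightarrow> \<exists>x \<in> insert (\<lambda>_. \<one>) (\<Union>m. L m). \<exists>N. \<forall>p\<ge>N. z p = x p"
    "\<And>m x. x \<in> L m \<Longrightarrow>
       \<exists>d. (\<forall>p<m. d p \<in> D) \<and> (\<forall>p\<ge>m. d p = \<one>) \<and> (\<lambda>p. x p \<otimes> inv d p) \<in> Z"
    by (rule compact_modulo_dense_finite_support[where L = L, OF metrizable dense Dc L_compact])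
      (rule that)
  have Zc: "Z \<subseteq> carrier (power_group G)"
    using compactin_subset_topspace[OF Z(1)] topspace_power_topology by simp
  define C where "C = blockwise \<psi> ` Z \<union> insert (\<lambda>_. \<one>) (\<Union>p. in_block G p ` K)"
  have C_compact: "compactin (power_topology T) C"
    unfolding C_def
    by (intro compactin_Un compactin_single_blocks image_compactin[OF Z(1)]
        continuous_map_blockwise K \<psi>(1))
  have Cc: "C \<subseteq> carrier (power_group G)"
    using compactin_subset_topspace[OF C_compact] topspace_power_topology by simp

  \<comment> \<open>A corrected element of \<open>r ` H\<close> keeps its far blocks, and a single block has trivial far
    blocks.\<close>
  have C_eventually: "C \<subseteq> eventually_blockwise_in G \<psi> (r ` H)"
  proof
    fix c assume c: "c \<in> C"
    have "\<exists>h\<in>r ` H. \<exists>N. \<forall>q. N \<le> block q \<longrightarrow> c q = blockwise \<psi> h q"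
    proof (cases "c \<in> blockwise \<psi> ` Z")
      case True
      then obtain z where z: "z \<in> Z" "c = blockwise \<psi> z" by (elim imageE)
      have "insert (\<lambda>_. \<one>) (\<Union>m. L m) = r ` H"
        unfolding L_Union using one_rH by (rule insert_absorb)
      then obtain x N where x: "x \<in> r ` H" "\<forall>p\<ge>N. z p = x p"
        using Z(2)[OF z(1)] by (elim bexE exE) simp
      have "\<forall>q. N \<le> block q \<longrightarrow> c q = blockwise \<psi> x q"
        using x(2) by (simp add: z(2) blockwise_def)
      then show ?thesis using x(1) by (intro bexI exI)
    next
      case False
      then consider "c = (\<lambda>_. \<one>)" | p k where "c = in_block G p k"
        using c unfolding C_def by auto
      then obtain N where "\<forall>q. N \<le> block q \<longrightarrow> c q = \<one>"
      proof cases
        case 2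
        then have "\<forall>q. Suc p \<le> block q \<longrightarrow> c q = \<one>" by (simp add: in_block_def)
        then show thesis by (rule that)
      qed (simp add: that)
      moreover have "blockwise \<psi> (\<lambda>_. \<one>) = (\<lambda>_. \<one>)"
        using B.hom_one by simp
      ultimately have "\<forall>q. N \<le> block q \<longrightarrow> c q = blockwise \<psi> (\<lambda>_. \<one>) q" by simp
      then show ?thesis using one_rH by (intro bexI exI)
    qed
    then show "c \<in> eventually_blockwise_in G \<psi> (r ` H)"
      using subsetD[OF Cc c] by (simp add: eventually_blockwise_in_def)
  qed

  have \<phi>_generate_imp: "x \<in> H"
    if x: "x \<in> carrier (power_group G)" "\<phi> x \<in> generate (power_group G) C" for x
  proof -
    have "\<phi> x \<in> eventually_blockwise_in G \<psi> (r ` H)"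
      using x(2) P.generate_subgroup_incl[OF C_eventually
          subgroup_eventually_blockwise_in[OF \<psi>(2) rH]] by blast
    then obtain h N where h: "h \<in> H" "\<And>q. N \<le> block q \<Longrightarrow> \<phi> x q = blockwise \<psi> (r h) q"
      unfolding eventually_blockwise_in_def by blast
    \<comment> \<open>Beyond any \<open>N\<close> there is a block in which \<open>\<phi> x\<close> shows the coordinate \<open>j\<close>.\<close>
    have "x j = h j" for j
    proof -
      obtain p where p: "p \<ge> N" "block p = j"
        using infinitely_many_indices_in_block by blast
      have "\<psi> (r x p) = \<psi> (r h p)"
        using h(2) p(1) by (intro blockwise_eqD) (simp add: \<phi>_def)
      then have "\<psi> (x j) = \<psi> (h j)" by (simp add: r_def p(2))
      moreover have "x j \<in> carrier G" "h j \<in> carrier G"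
        using x(1) subsetD[OF Hc h(1)] unfolding in_carrier_power_group by simp_all
      ultimately show ?thesis using \<psi>(3) by (simp add: inj_on_eq_iff)
    qed
    then have "x = h" by (rule ext)
    then show ?thesis using h(1) by simp
  qed

  have \<phi>_generate: "\<phi> x \<in> generate (power_group G) C" if x: "x \<in> H" for x
  proof -
    obtain m where m: "r x \<in> L m" using L_Union x by blast
    obtain d where d: "\<And>p. p < m \<Longrightarrow> d p \<in> D" "\<And>p. p \<ge> m \<Longrightarrow> d p = \<one>"
      and z: "(\<lambda>p. r x p \<otimes> inv d p) \<in> Z"
      using Z(3)[OF m] by blast
    have rc: "r x p \<in> carrier G" for p
      using r.hom_closed[OF subsetD[OF Hc x]] unfolding in_carrier_power_group by simp
    have dc: "d p \<in> carrier G" for p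
      using d(1)[of p] d(2)[of p] subsetD[OF Dc, of "d p"] by (cases "p < m") simp_all
    have "blockwise \<psi> d \<in> generate (power_group G) C"
    proof (rule blockwise_finite_support_in_generate[OF \<psi>(2) Kc])
      show "in_block G p ` K \<subseteq> C" for p
        unfolding C_def by blast
      show "d p \<in> carrier G \<and> \<psi> (d p) \<in> generate (power_group G) K" if "p < m" for p
        using d(1)[OF that] unfolding D by simp
      show "d p = \<one>" if "p \<ge> m" for p
        using that by (rule d(2))
    qed
    moreover have "blockwise \<psi> (\<lambda>p. r x p \<otimes> inv d p) \<in> generate (power_group G) C"
      using z by (intro generate.incl) (simp add: C_def)
    ultimately have "blockwise \<psi> (\<lambda>p. r x p \<otimes> inv d p) \<otimes>\<^bsub>power_group G\<^esub> blockwise \<psi> d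
        \<in> generate (power_group G) C"
      by (rule generate.eng[rotated])
    also have "blockwise \<psi> (\<lambda>p. r x p \<otimes> inv d p) \<otimes>\<^bsub>power_group G\<^esub> blockwise \<psi> d
        = blockwise \<psi> ((\<lambda>p. r x p \<otimes> inv d p) \<otimes>\<^bsub>power_group G\<^esub> d)"
      using subsetD[OF Zc z] dc
      by (intro B.hom_mult[symmetric]) (simp_all add: in_carrier_power_group del: carrier_product_group)
    also have "(\<lambda>p. r x p \<otimes> inv d p) \<otimes>\<^bsub>power_group G\<^esub> d = r x"
      using rc dc by (simp add: m_assoc)
    finally show ?thesis by (simp add: \<phi>_def)
  qed

  have "continuous_map (power_topology T) (power_topology T) \<phi>"
    unfolding \<phi>_def using r_cont continuous_map_blockwise[OF \<psi>(1)]
    by (rule continuous_map_compose)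
  moreover have "\<phi> \<in> hom (power_group G) (power_group G)"
    unfolding \<phi>_def using r.homh B.homh by (rule Group.hom_compose)
  moreover have "inj_on \<phi> (carrier (power_group G))"
  proof (rule inj_onI)
    fix x y assume xy: "x \<in> carrier (power_group G)" "y \<in> carrier (power_group G)" "\<phi> x = \<phi> y"
    have "x j = y j" for j
    proof -
      obtain p where p: "block p = j"
        using infinitely_many_indices_in_block by blast
      have "\<psi> (r x p) = \<psi> (r y p)"
        using xy(3) by (intro blockwise_eqD) (simp add: \<phi>_def)
      then have "\<psi> (x j) = \<psi> (y j)" by (simp add: r_def p)
      moreover have "x j \<in> carrier G" "y j \<in> carrier G"
        using xy(1,2) unfolding in_carrier_power_group by simp_all
      ultimately show ?thesis using \<psi>(3) by (simp add: inj_on_eq_iff)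
    qed
    then show "x = y" by (rule ext)
  qed
  moreover have "H = {x \<in> carrier (power_group G). \<phi> x \<in> generate (power_group G) C}"
    using Hc \<phi>_generate \<phi>_generate_imp by blast
  ultimately show ?thesis
    unfolding almost_compactly_generated_def using H(1) C_compact by blast
qed

theorem theorem4p5:
  fixes G :: "('a, 'b) monoid_scheme" and T :: "'a topology"
    and D :: "'a set" and K :: "(nat \<Rightarrow> 'a) set" and \<psi> :: "'a \<Rightarrow> nat \<Rightarrow> 'a"
    and H :: "(nat \<Rightarrow> 'a) set"
  assumes "polish_group G T"
    and "subgroup D G" and "T closure_of D = topspace T"
    and "compactin (power_topology T) K"
    and "continuous_map T (power_topology T) \<psi>"
    and "\<psi> \<in> hom G (power_group G)" and "inj_on \<psi> (carrier G)"
    and "D = {x \<in> carrier G. \<psi> x \<in> generate (power_group G) K}"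
    and "subgroup H (power_group G)" and "K_sigma_in (power_topology T) H"
  shows "almost_compactly_generated (power_group G) (power_topology T) H"
proof -
  interpret polish_group G T by fact
  show ?thesis
    using K_sigma_subgroup_almost_compactly_generated[OF
        completely_metrizable_imp_metrizable_space[OF completely_metrizable] assms(3-10)] .
qed

end
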